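(* Let $0<q<1$. Let $(P_n)_{n\ge 0}$ be a monic orthogonal polynomial sequence (monic OPS), with $P_{-1}:=0$. Then there exists a sequence of complex numbers $(k_n)_{n\ge 0}$ such that $$\mathcal{D}_q\mathcal{S}_qP_{n}(z)= k_nP_{n-1}(z)\qquad (n=0,1,2,\ldots)$$ if and only if $(P_n)_{n\ge0}$ is the sequence of monic Rogers $q^{2}$-Hermite polynomials or the sequence of monic Rogers $q^{-2}$-Hermite polynomials.
   Context: Let $\mathcal{P}$ be the space of polynomials in one variable $z$ with complex coefficients. For $p\in\mathcal{P}$, with $z=x(\sigma)=\frac12(q^{\sigma}+q^{-\sigma})$, the Askey-Wilson operator $\mathcal{D}_q$ and the averaging operator $\mathcal{S}_q$ are the linear maps $\mathcal{P}\to\mathcal{P}$ defined by $$\mathcal{D}_q p(x(\sigma))=\frac{p(x(\sigma+\frac12))-p(x(\sigma-\frac12))}{x(\sigma+\frac12)-x(\sigma-\frac12)},\qquad \mathcal{S}_q p(x(\sigma))=\tfrac12\Big(p(x(\sigma+\tfrac12))+p(x(\sigma-\tfrac12))\Big).$$ A monic OPS is a sequence of monic polynomials $P_n$ with $\deg P_n=n$ for which there is a linear functional $\mathbf{w}:\mathcal{P}\to\mathbb{C}$ and nonzero complex numbers $h_n$ with $\langle \mathbf{w},P_jP_n\rangle=h_n\delta_{j,n}$. Equivalently, $P_{-1}=0$, $P_0=1$ and $P_{n+1}(z)=(z-B_n)P_n(z)-C_nP_{n-1}(z)$ with $B_n\in\mathbb{C}$ ($n\ge0$) and $C_n\in\mathbb{C}\setminus\{0\}$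 ($n\ge1$). (Orthogonality is in this formal sense; no positivity is required.) For $p>0$, $p\ne1$, the monic Rogers $p$-Hermite polynomials $(H_n)_{n\ge0}$ are defined by $H_{-1}=0$, $H_0=1$ and $H_{n+1}(x)=xH_n(x)-\frac14(1-p^n)H_{n-1}(x)$ for $n\ge 0$ (the Al-Salam-Chihara polynomials with both parameters equal to $0$ and base $p$). *)

theory Defs
  imports
    "HOL-Analysis.Analysis"
    "HOL-Computational_Algebra.Polynomial"
begin

text \<open>The lattice \<open>x(\<sigma>) = (q^\<sigma> + q^(-\<sigma>)) / 2\<close>, with \<open>\<sigma>\<close> ranging over all complex numbers and
  \<open>q^\<sigma> = exp (\<sigma> ln q)\<close> for \<open>q > 0\<close>. For \<open>q \<noteq> 1\<close> it takes every complex value.\<close>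

definition qx :: "real \<Rightarrow> complex \<Rightarrow> complex" where
  "qx q \<sigma> = (complex_of_real q powr \<sigma> + complex_of_real q powr (- \<sigma>)) / 2"

text \<open>The operators are the polynomials determined by their values on the lattice. The quotient is
  only required where its denominator does not vanish, since \<open>y / 0 = 0\<close> in HOL; existence and
  uniqueness of both polynomials are proved below.\<close>

definition askey_wilson :: "real \<Rightarrow> complex poly \<Rightarrow> complex poly" where
  "askey_wilson q p = (THE r. \<forall>\<sigma>. qx q (\<sigma> + 1/2) \<noteq> qx q (\<sigma> - 1/2) \<longrightarrow>
     poly r (qx q \<sigma>) =
       (poly p (qx q (\<sigma> + 1/2)) - poly p (qx q (\<sigma> - 1/2))) / (qx q (\<sigma> + 1/2) - qx q (\<sigma> - 1/2)))"

definition averaging :: "real \<Rightarrow> complex poly \<Rightarrow> complex poly" where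
  "averaging q p = (THE r. \<forall>\<sigma>.
     poly r (qx q \<sigma>) = (poly p (qx q (\<sigma> + 1/2)) + poly p (qx q (\<sigma> - 1/2))) / 2)"

definition monic_OPS :: "(nat \<Rightarrow> complex poly) \<Rightarrow> bool" where
  "monic_OPS P \<longleftrightarrow>
     (\<forall>n. degree (P n) = n \<and> lead_coeff (P n) = 1) \<and>
     (\<exists>(w :: complex poly \<Rightarrow> complex) (h :: nat \<Rightarrow> complex).
        Vector_Spaces.linear smult (*) w \<and>
        (\<forall>n. h n \<noteq> 0) \<and>
        (\<forall>j n. w (P j * P n) = (if j = n then h n else 0)))"

text \<open>The sequence shifted by one index, with the convention \<open>P\<^bsub>-1\<^esub> = 0\<close>.\<close>

definition prev :: "(nat \<Rightarrow> complex poly) \<Rightarrow> nat \<Rightarrow> complex poly" where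
  "prev P n = (case n of 0 \<Rightarrow> 0 | Suc m \<Rightarrow> P m)"

text \<open>Monic Rogers \<open>p\<close>-Hermite polynomials. The second equation is the recurrence at \<open>n = 0\<close>, where
  \<open>H\<^bsub>-1\<^esub> = 0\<close>; the third is the recurrence at \<open>n + 1\<close>.\<close>

fun rogers_hermite :: "real \<Rightarrow> nat \<Rightarrow> complex poly" where
  "rogers_hermite p 0 = 1"
| "rogers_hermite p (Suc 0) = [:0, 1:]"
| "rogers_hermite p (Suc (Suc n)) =
     [:0, 1:] * rogers_hermite p (Suc n)
       - smult (complex_of_real ((1 - p ^ Suc n) / 4)) (rogers_hermite p n)"

lemma qx_exp:
  assumes "0 < q"
  shows "qx q \<sigma> = (exp (\<sigma> * of_real (ln q)) + exp (- (\<sigma> * of_real (ln q)))) / 2"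
  using assms by (simp add: qx_def powr_def Ln_of_real)

lemma qx_surj:
  assumes "0 < q" "q \<noteq> 1"
  obtains \<sigma> where "qx q \<sigma> = z"
proof -
  define s where "s = csqrt (z\<^sup>2 - 1)"
  define u where "u = z + s"
  have s2: "s * s = z * z - 1"
    unfolding s_def by (metis power2_csqrt power2_eq_square)
  have uv: "u * (z - s) = 1"
    using s2 by (simp add: u_def algebra_simps)
  then have "u \<noteq> 0" by auto
  then have inv: "inverse u = z - s"
    using uv by (simp add: inverse_unique)
  have ln: "complex_of_real (ln q) \<noteq> 0" using assms by simp
  have "qx q (Ln u / of_real (ln q)) = (u + inverse u) / 2"
    using ln \<open>u \<noteq> 0\<close> assms by (simp add: qx_exp exp_minus)
  also have "\<dots> = z" unfolding inv by (simp add: u_def)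
  finally show thesis by (rule that)
qed

lemma qx_shift:
  assumes "0 < q"
  defines "\<alpha> \<equiv> qx q (1/2)"
  shows "qx q (\<sigma> + 1/2) + qx q (\<sigma> - 1/2) = 2 * \<alpha> * qx q \<sigma>"
    and "(qx q (\<sigma> + 1/2) - qx q (\<sigma> - 1/2))\<^sup>2 = 4 * (\<alpha>\<^sup>2 - 1) * ((qx q \<sigma>)\<^sup>2 - 1)"
proof -
  define u where "u = exp (\<sigma> * of_real (ln q))"
  define v where "v = exp (of_real (ln q) / 2 :: complex)"
  have nz: "u \<noteq> 0" "v \<noteq> 0" by (auto simp: u_def v_def)
  have e: "qx q \<sigma> = (u + 1 / u) / 2" "\<alpha> = (v + 1 / v) / 2"
     "qx q (\<sigma> + 1/2) = (u * v + 1 / (u * v)) / 2"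
     "qx q (\<sigma> - 1/2) = (u / v + v / u) / 2"
    using assms
    by (simp_all add: qx_exp u_def v_def exp_add exp_diff exp_minus algebra_simps inverse_eq_divide)
  show "qx q (\<sigma> + 1/2) + qx q (\<sigma> - 1/2) = 2 * \<alpha> * qx q \<sigma>"
    unfolding e using nz by (simp add: field_simps)
  show "(qx q (\<sigma> + 1/2) - qx q (\<sigma> - 1/2))\<^sup>2 = 4 * (\<alpha>\<^sup>2 - 1) * ((qx q \<sigma>)\<^sup>2 - 1)"
    unfolding e using nz by (simp add: field_simps power2_eq_square)
qed

lemma operators_exist:
  assumes "0 < q"
  shows "\<exists>d s. \<forall>\<sigma>.
     poly p (qx q (\<sigma> + 1/2)) - poly p (qx q (\<sigma> - 1/2))
       = (qx q (\<sigma> + 1/2) - qx q (\<sigma> - 1/2)) * poly d (qx q \<sigma>) \<and>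
     poly p (qx q (\<sigma> + 1/2)) + poly p (qx q (\<sigma> - 1/2)) = 2 * poly s (qx q \<sigma>)"
proof (induction p)
  case 0
  show ?case by (rule exI[of _ 0], rule exI[of _ 0]) simp
next
  case (pCons c p)
  define \<alpha> where "\<alpha> = qx q (1/2)"
  from pCons.IH obtain d s where
    d: "\<And>\<sigma>. poly p (qx q (\<sigma> + 1/2)) - poly p (qx q (\<sigma> - 1/2))
       = (qx q (\<sigma> + 1/2) - qx q (\<sigma> - 1/2)) * poly d (qx q \<sigma>)" and
    s: "\<And>\<sigma>. poly p (qx q (\<sigma> + 1/2)) + poly p (qx q (\<sigma> - 1/2)) = 2 * poly s (qx q \<sigma>)"
    by blast
  define d' where "d' = [:0, \<alpha>:] * d + s"
  define s' where "s' = [:c:] + [:0, \<alpha>:] * s + smult (\<alpha>\<^sup>2 - 1) ([:-1, 0, 1:] * d)"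
  show ?case
  proof (rule exI[of _ d'], rule exI[of _ s'], rule allI)
    fix \<sigma>
    define a b z where "a = qx q (\<sigma> + 1/2)" and "b = qx q (\<sigma> - 1/2)" and "z = qx q \<sigma>"
    have ab: "a + b = 2 * \<alpha> * z" "(a - b)\<^sup>2 = 4 * (\<alpha>\<^sup>2 - 1) * (z\<^sup>2 - 1)"
      unfolding a_def b_def z_def \<alpha>_def using qx_shift[OF assms] by auto
    have D: "poly p a - poly p b = (a - b) * poly d z" and S: "poly p a + poly p b = 2 * poly s z"
      unfolding a_def b_def z_def using d s by auto
    have "2 * (a * poly p a - b * poly p b)
        = (a + b) * (poly p a - poly p b) + (a - b) * (poly p a + poly p b)"
      by (simp add: algebra_simps)
    also have "\<dots> = 2 * ((a - b) * poly d' z)"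
      unfolding D S ab d'_def by (simp add: algebra_simps)
    finally have 1: "a * poly p a - b * poly p b = (a - b) * poly d' z"
      by (simp only: mult_cancel_left) simp
    have "2 * (a * poly p a + b * poly p b)
        = (a + b) * (poly p a + poly p b) + (a - b) * (poly p a - poly p b)"
      by (simp add: algebra_simps)
    also have "\<dots> = 4 * \<alpha> * z * poly s z + (a - b)\<^sup>2 * poly d z"
      unfolding D S ab(1) by (simp add: power2_eq_square)
    also have "\<dots> = 4 * (poly s' z - c)"
      unfolding ab(2) s'_def by (simp add: algebra_simps power2_eq_square)
    finally have "2 * (a * poly p a + b * poly p b + 2 * c) = 2 * (2 * poly s' z)"
      by (simp add: algebra_simps)
    then have 2: "a * poly p a + b * poly p b + 2 * c = 2 * poly s' z"
      by (simp only: mult_cancel_left) simp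
    show "poly (pCons c p) (qx q (\<sigma> + 1/2)) - poly (pCons c p) (qx q (\<sigma> - 1/2))
         = (qx q (\<sigma> + 1/2) - qx q (\<sigma> - 1/2)) * poly d' (qx q \<sigma>) \<and>
       poly (pCons c p) (qx q (\<sigma> + 1/2)) + poly (pCons c p) (qx q (\<sigma> - 1/2))
         = 2 * poly s' (qx q \<sigma>)"
      using 1 2 unfolding a_def[symmetric] b_def[symmetric] z_def[symmetric]
      by (simp add: algebra_simps)
  qed
qed

lemma poly_eq_off_finite:
  fixes r t :: "complex poly"
  assumes "finite A" "\<And>z. z \<notin> A \<Longrightarrow> poly r z = poly t z"
  shows "r = t"
proof (rule ccontr)
  assume "r \<noteq> t"
  then have "finite {z. poly (r - t) z = 0}" by (intro poly_roots_finite) simp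
  moreover have "UNIV \<subseteq> A \<union> {z. poly (r - t) z = 0}" using assms(2) by auto
  ultimately show False
    using assms(1) infinite_UNIV_char_0 by (metis finite_Un finite_subset)
qed

lemma qx_shift_eq_iff:
  assumes "0 < q" "q \<noteq> 1"
  shows "qx q (\<sigma> + 1/2) = qx q (\<sigma> - 1/2) \<longleftrightarrow> (qx q \<sigma>)\<^sup>2 = 1"
proof -
  define v where "v = exp (ln q / 2)"
  have "v > 0" "v \<noteq> 1" using assms by (auto simp: v_def)
  then have "v * v \<noteq> 1" by (auto simp: square_eq_1_iff)
  then have "v \<noteq> inverse v" using \<open>v > 0\<close> by (metis less_irrefl right_inverse)
  then have "(v - inverse v)\<^sup>2 \<noteq> 0" by simp
  have "qx q (1/2) = complex_of_real ((v + inverse v) / 2)"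
    using assms by (simp add: qx_exp v_def exp_minus exp_of_real[symmetric])
  moreover have "((v + inverse v) / 2)\<^sup>2 - 1 = (v - inverse v)\<^sup>2 / 4"
    using \<open>v > 0\<close> by (simp add: field_simps power2_eq_square)
  ultimately have "(qx q (1/2))\<^sup>2 - 1 = complex_of_real ((v - inverse v)\<^sup>2 / 4)"
    by (metis of_real_1 of_real_diff of_real_power)
  with \<open>(v - inverse v)\<^sup>2 \<noteq> 0\<close> have "(qx q (1/2))\<^sup>2 - 1 \<noteq> 0"
    by (metis divide_eq_0_iff of_real_eq_0_iff zero_neq_numeral)
  then show ?thesis
    using qx_shift(2)[OF assms(1), of \<sigma>] by (metis (no_types, lifting) eq_iff_diff_eq_0
        mult_eq_0_iff power2_eq_square zero_neq_numeral)
qed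

lemma askey_wilson_unique_existence:
  assumes "0 < q" "q \<noteq> 1"
  shows "\<exists>!r. \<forall>\<sigma>. qx q (\<sigma> + 1/2) \<noteq> qx q (\<sigma> - 1/2) \<longrightarrow>
     poly r (qx q \<sigma>) =
       (poly p (qx q (\<sigma> + 1/2)) - poly p (qx q (\<sigma> - 1/2))) / (qx q (\<sigma> + 1/2) - qx q (\<sigma> - 1/2))"
    (is "\<exists>!r. ?Q r")
proof (rule ex_ex1I)
  show "\<exists>r. ?Q r"
    using operators_exist[OF assms(1), of p] by (metis eq_iff_diff_eq_0 nonzero_mult_div_cancel_left)
next
  fix r t assume "?Q r" "?Q t"
  show "r = t"
  proof (rule poly_eq_off_finite[of "{1, -1}"])
    fix z :: complex assume z: "z \<notin> {1, -1}"
    obtain \<sigma> where \<sigma>: "qx q \<sigma> = z" using qx_surj[OF assms] by blast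
    have "z\<^sup>2 \<noteq> 1" using z by (auto simp: power2_eq_1_iff)
    then have "qx q (\<sigma> + 1/2) \<noteq> qx q (\<sigma> - 1/2)" using qx_shift_eq_iff[OF assms] \<sigma> by simp
    then show "poly r z = poly t z" using \<open>?Q r\<close> \<open>?Q t\<close> \<sigma> by metis
  qed simp
qed

lemma averaging_unique_existence:
  assumes "0 < q" "q \<noteq> 1"
  shows "\<exists>!r. \<forall>\<sigma>. poly r (qx q \<sigma>) = (poly p (qx q (\<sigma> + 1/2)) + poly p (qx q (\<sigma> - 1/2))) / 2"
    (is "\<exists>!r. ?Q r")
proof (rule ex_ex1I)
  obtain s where "\<And>\<sigma>. poly p (qx q (\<sigma> + 1/2)) + poly p (qx q (\<sigma> - 1/2)) = 2 * poly s (qx q \<sigma>)"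
    using operators_exist[OF assms(1), of p] by blast
  then show "\<exists>r. ?Q r" by (intro exI[of _ s]) simp
next
  fix r t assume "?Q r" "?Q t"
  show "r = t"
  proof (rule poly_eq_off_finite[of "{}"])
    fix z :: complex
    obtain \<sigma> where "qx q \<sigma> = z" using qx_surj[OF assms] by blast
    then show "poly r z = poly t z" using \<open>?Q r\<close> \<open>?Q t\<close> by metis
  qed simp
qed

lemmas poly_askey_wilson =
  askey_wilson_unique_existence[THEN theI', folded askey_wilson_def, rule_format]

lemmas poly_averaging =
  averaging_unique_existence[THEN theI', folded averaging_def, rule_format]

end

theory Submission
  imports Defs
begin

text \<open>Telescoping gives \<open>\<D>\<^sub>q \<S>\<^sub>q = \<alpha> D\<close>, where \<open>\<alpha> \<noteq> 0\<close> and \<open>D\<close> is the Askey-Wilson operator of base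
  \<open>q\<^sup>2\<close>, so the condition says that \<open>P\<close> is an Appell sequence for \<open>D\<close>. The operator \<open>D\<close> does not change
  under \<open>q \<mapsto> 1 / q\<close>, which is why two families occur. A sequence that satisfies a three-term
  recurrence and is Appell for \<open>D\<close> is determined by its terms of degree at most 2: if
  \<open>P\<^sub>n\<close>, \<open>P\<^bsub>n-1\<^esub>\<close>, \<open>P\<^bsub>n-2\<^esub>\<close> are Hermite polynomials with \<open>n \<ge> 2\<close>, then
  \<open>P\<^bsub>n+1\<^esub> = H\<^bsub>n+1\<^esub> - b H\<^sub>n - d H\<^bsub>n-1\<^esub>\<close>, and applying \<open>D\<close> forces \<open>b = d = 0\<close>. It remains to see
  that \<open>P\<^sub>1\<close> and \<open>P\<^sub>2\<close> are those of one of the two families, which is a comparison of coefficients up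
  to degree 5.\<close>

section \<open>Values on the lattice, linearity and product rules of the two operators\<close>

lemma askey_wilson_eqI:
  assumes "0 < q" "q \<noteq> 1"
    and "\<And>\<sigma>. poly p (qx q (\<sigma> + 1/2)) - poly p (qx q (\<sigma> - 1/2))
       = (qx q (\<sigma> + 1/2) - qx q (\<sigma> - 1/2)) * poly r (qx q \<sigma>)"
  shows "askey_wilson q p = r"
  unfolding askey_wilson_def
  by (rule the1_equality[OF askey_wilson_unique_existence[OF assms(1,2)]]) (simp add: assms(3))

lemma averaging_eqI:
  assumes "0 < q" "q \<noteq> 1"
    and "\<And>\<sigma>. poly p (qx q (\<sigma> + 1/2)) + poly p (qx q (\<sigma> - 1/2)) = 2 * poly r (qx q \<sigma>)"
  shows "averaging q p = r"
  unfolding averaging_def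
  by (rule the1_equality[OF averaging_unique_existence[OF assms(1,2)]]) (simp add: assms(3))

text \<open>Multiplying out the denominator removes the exceptional \<open>\<sigma>\<close>: where
  the two lattice points coincide, both sides are 0.\<close>

lemma poly_shift_diff:
  assumes "0 < q" "q \<noteq> 1"
  shows "poly p (qx q (\<sigma> + 1/2)) - poly p (qx q (\<sigma> - 1/2))
       = (qx q (\<sigma> + 1/2) - qx q (\<sigma> - 1/2)) * poly (askey_wilson q p) (qx q \<sigma>)"
  by (cases "qx q (\<sigma> + 1/2) = qx q (\<sigma> - 1/2)") (simp_all add: poly_askey_wilson[OF assms])

lemma poly_shift_sum:
  assumes "0 < q" "q \<noteq> 1"
  shows "poly p (qx q (\<sigma> + 1/2)) + poly p (qx q (\<sigma> - 1/2)) = 2 * poly (averaging q p) (qx q \<sigma>)"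
  by (simp add: poly_averaging[OF assms])

lemma askey_wilson_linear:
  assumes "0 < q" "q \<noteq> 1"
  shows "askey_wilson q (p - r) = askey_wilson q p - askey_wilson q r"
    and "askey_wilson q (smult c p) = smult c (askey_wilson q p)"
    and "askey_wilson q 0 = 0"
  by (rule askey_wilson_eqI[OF assms];
      use poly_shift_diff[OF assms, of p] poly_shift_diff[OF assms, of r] in
      \<open>simp add: algebra_simps; metis right_diff_distrib distrib_left\<close>)+

lemma averaging_linear:
  assumes "0 < q" "q \<noteq> 1"
  shows "averaging q (p - r) = averaging q p - averaging q r"
    and "averaging q (smult c p) = smult c (averaging q p)"
    and "averaging q 0 = 0"
  by (rule averaging_eqI[OF assms]; simp add: poly_averaging[OF assms] algebra_simps add_divide_distrib)+

text \<open>Product rules for multiplication by z. With a, b the shifted lattice points, 2(a p(a) -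
  b p(b)) = (a + b)(p(a) - p(b)) + (a - b)(p(a) + p(b)), and similarly for the sum;
  \<open>qx_shift\<close> evaluates a + b and (a - b)^2. Each rule involves the other operator, so
  both are computed together, one coefficient at a time.\<close>

lemma operators_pCons:
  assumes "0 < q" "q \<noteq> 1"
  defines "\<alpha> \<equiv> qx q (1/2)"
  shows "askey_wilson q (pCons c p) = averaging q p + smult \<alpha> (pCons 0 (askey_wilson q p))"
    and "averaging q (pCons c p) = [:c:] + smult \<alpha> (pCons 0 (averaging q p))
      + smult (\<alpha>\<^sup>2 - 1) ([:-1, 0, 1:] * askey_wilson q p)"
proof -
  define d s where "d = askey_wilson q p" and "s = averaging q p"
  have *: "(a * poly p a - b * poly p b = (a - b) * (poly s z + \<alpha> * z * poly d z)) \<and>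
      a * poly p a + b * poly p b = 2 * (\<alpha> * z * poly s z + (\<alpha>\<^sup>2 - 1) * (z\<^sup>2 - 1) * poly d z)"
    if "a = qx q (\<sigma> + 1/2)" "b = qx q (\<sigma> - 1/2)" "z = qx q \<sigma>" for \<sigma> a b z
  proof -
    have ab: "a + b = 2 * \<alpha> * z" "(a - b)\<^sup>2 = 4 * (\<alpha>\<^sup>2 - 1) * (z\<^sup>2 - 1)"
      unfolding that \<alpha>_def using qx_shift[OF assms(1)] by auto
    have DS: "poly p a - poly p b = (a - b) * poly d z" "poly p a + poly p b = 2 * poly s z"
      unfolding that d_def s_def
      using poly_shift_diff[OF assms(1,2)] poly_shift_sum[OF assms(1,2)] by auto
    have "2 * (a * poly p a - b * poly p b)
        = (a + b) * (poly p a - poly p b) + (a - b) * (poly p a + poly p b)"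
      by (simp add: algebra_simps)
    also have "\<dots> = 2 * ((a - b) * (poly s z + \<alpha> * z * poly d z))"
      unfolding DS ab(1) by (simp add: algebra_simps)
    finally have 1: "a * poly p a - b * poly p b = (a - b) * (poly s z + \<alpha> * z * poly d z)"
      by (simp only: mult_cancel_left) simp
    have "2 * (a * poly p a + b * poly p b)
        = (a + b) * (poly p a + poly p b) + (a - b) * (poly p a - poly p b)"
      by (simp add: algebra_simps)
    also have "\<dots> = 4 * \<alpha> * z * poly s z + (a - b)\<^sup>2 * poly d z"
      unfolding DS ab(1) by (simp add: power2_eq_square)
    also have "\<dots> = 2 * (2 * (\<alpha> * z * poly s z + (\<alpha>\<^sup>2 - 1) * (z\<^sup>2 - 1) * poly d z))"
      unfolding ab(2) by (simp add: algebra_simps)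
    finally show ?thesis using 1 by (simp only: mult_cancel_left) simp
  qed
  show "askey_wilson q (pCons c p) = averaging q p + smult \<alpha> (pCons 0 (askey_wilson q p))"
    by (rule askey_wilson_eqI[OF assms(1,2)])
      (use *[OF refl refl refl] in \<open>simp add: d_def s_def algebra_simps\<close>)
  show "averaging q (pCons c p) = [:c:] + smult \<alpha> (pCons 0 (averaging q p))
      + smult (\<alpha>\<^sup>2 - 1) ([:-1, 0, 1:] * askey_wilson q p)"
    by (rule averaging_eqI[OF assms(1,2)])
      (use *[OF refl refl refl] in \<open>simp add: d_def s_def algebra_simps power2_eq_square\<close>)
qed

section \<open>The composition of the Askey-Wilson and averaging operators\<close>

text \<open>The middle value p(x(\<sigma>)) cancels, which leaves the values at \<sigma> + 1 and
  \<sigma> - 1; these are half-step neighbours on the lattice of base q^2. The factor x(1/2) is half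
  the ratio of the two denominators.\<close>

lemma askey_wilson_averaging:
  assumes "0 < q" "q \<noteq> 1"
  shows "askey_wilson q (averaging q p) = smult (qx q (1/2)) (askey_wilson (q\<^sup>2) p)"
proof (rule askey_wilson_eqI[OF assms])
  fix \<sigma>
  have q2: "0 < q\<^sup>2" "q\<^sup>2 \<noteq> 1" using assms by (auto simp: power2_eq_1_iff)
  have dbl: "qx (q\<^sup>2) \<tau> = qx q (2 * \<tau>)" for \<tau>
    using assms by (simp add: qx_exp ln_realpow algebra_simps)
  define x where "x = qx q"
  have S: "poly (averaging q p) (x \<rho>) = (poly p (x (\<rho> + 1/2)) + poly p (x (\<rho> - 1/2))) / 2" for \<rho>
    unfolding x_def by (rule poly_averaging[OF assms])
  have D: "poly p (x (\<sigma> + 1)) - poly p (x (\<sigma> - 1))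
      = (x (\<sigma> + 1) - x (\<sigma> - 1)) * poly (askey_wilson (q\<^sup>2) p) (x \<sigma>)"
    using poly_shift_diff[OF q2, of p "\<sigma> / 2"] unfolding dbl x_def by (simp add: algebra_simps)
  have "x (\<sigma> + 1) + x \<sigma> = 2 * x (1/2) * x (\<sigma> + 1/2)"
    "x \<sigma> + x (\<sigma> - 1) = 2 * x (1/2) * x (\<sigma> - 1/2)"
    using qx_shift(1)[OF assms(1), of "\<sigma> + 1/2"] qx_shift(1)[OF assms(1), of "\<sigma> - 1/2"]
    by (simp_all add: x_def add.commute)
  note sum = this
  have "x (\<sigma> + 1) - x (\<sigma> - 1) = (x (\<sigma> + 1) + x \<sigma>) - (x \<sigma> + x (\<sigma> - 1))" by simp
  also have "\<dots> = 2 * x (1/2) * (x (\<sigma> + 1/2) - x (\<sigma> - 1/2))"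
    unfolding sum by (simp add: right_diff_distrib)
  finally have diff: "x (\<sigma> + 1) - x (\<sigma> - 1) = 2 * x (1/2) * (x (\<sigma> + 1/2) - x (\<sigma> - 1/2))" .
  have "poly (averaging q p) (x (\<sigma> + 1/2)) - poly (averaging q p) (x (\<sigma> - 1/2))
      = (poly p (x (\<sigma> + 1)) - poly p (x (\<sigma> - 1))) / 2"
    unfolding S by (simp add: diff_divide_distrib add_divide_distrib add.commute)
  also have "\<dots> = (x (\<sigma> + 1/2) - x (\<sigma> - 1/2))
      * poly (smult (x (1/2)) (askey_wilson (q\<^sup>2) p)) (x \<sigma>)"
    unfolding D diff by simp
  finally show "poly (averaging q p) (qx q (\<sigma> + 1/2)) - poly (averaging q p) (qx q (\<sigma> - 1/2))
      = (qx q (\<sigma> + 1/2) - qx q (\<sigma> - 1/2)) * poly (smult (qx q (1/2)) (askey_wilson (q\<^sup>2) p)) (qx q \<sigma>)"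
    unfolding x_def .
qed

section \<open>From orthogonality to a three-term recurrence\<close>

text \<open>The remainder \<open>f\<close> of the recurrence has degree at most n + 1 and pairs to
  zero with every \<open>P j\<close> of such degree. For j < n the factor z is moved from
  \<open>P (Suc n)\<close> to \<open>P j\<close>, whose degree stays below n + 1. Pairing
  \<open>f\<close> with \<open>P (degree f)\<close> gives its leading coefficient times a nonzero
  number, so \<open>f\<close> vanishes.\<close>

lemma monic_OPS_recurrence:
  assumes "monic_OPS P"
  obtains B C where "\<And>n. P (Suc (Suc n)) = [:- B n, 1:] * P (Suc n) - smult (C n) (P n)"
    and "\<And>n. C n \<noteq> 0"
proof -
  from assms obtain w h where deg: "\<And>n. degree (P n) = n" and lead: "\<And>n. coeff (P n) n = 1"
    and lin: "Vector_Spaces.linear smult (*) w" and h: "\<And>n. h n \<noteq> (0 :: complex)"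
    and w: "\<And>j n. w (P j * P n) = (if j = n then h n else 0)"
    unfolding monic_OPS_def by metis
  interpret w: Vector_Spaces.linear smult "(*)" w by (rule lin)
  note wl = w.add w.diff w.scale w.zero
  \<comment> \<open>The zero polynomial is a separate case because it has degree 0, so that at
    \<open>d = 0\<close> no drop in degree is possible.\<close>
  have red: "degree (f - smult (coeff f d) (P d)) < d \<or> f - smult (coeff f d) (P d) = 0"
    if "degree f \<le> d" for f d
  proof (cases "d = 0")
    case True
    then show ?thesis using that deg[of 0] lead[of 0] by (auto elim!: degree_eq_zeroE)
  next
    case False
    have "degree (f - smult (coeff f d) (P d)) \<le> d"
      by (rule degree_diff_le) (use that deg[of d] degree_smult_le le_trans in \<open>metis+\<close>)
    moreover have "coeff (f - smult (coeff f d) (P d)) d = 0" by (simp add: lead)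
    ultimately show ?thesis using False
      by (metis leading_coeff_0_iff le_neq_implies_less)
  qed
  have orth: "w (f * P n) = 0" if "degree f < n \<or> f = 0" for f n
    using that
  proof (induction "degree f" arbitrary: f rule: less_induct)
    case less
    define g where "g = f - smult (coeff f (degree f)) (P (degree f))"
    have f: "f = g + smult (coeff f (degree f)) (P (degree f))" by (simp add: g_def)
    show ?case
    proof (cases "f = 0")
      case False
      then have n: "degree f < n" using less by auto
      have "w (g * P n) = 0"
      proof (cases "g = 0")
        case False
        then have "degree g < degree f" using red[of f "degree f"] g_def by auto
        then show ?thesis using less(1) n by (meson less_trans)
      qed (simp add: wl)
      moreover have "w (P (degree f) * P n) = 0" using w n by simp
      ultimately show ?thesis by (subst f) (simp add: wl distrib_right)
    qed (simp add: wl)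
  qed
  have lead_w: "w (f * P d) = coeff f d * h d" if "degree f \<le> d" for f d
  proof -
    have "w ((f - smult (coeff f d) (P d)) * P d) = 0" by (rule orth) (rule red[OF that])
    then show ?thesis by (simp add: left_diff_distrib wl w)
  qed
  \<comment> \<open>The values for which the remainder pairs to zero with \<open>P (Suc n)\<close>
    and with \<open>P n\<close>.\<close>
  define B where "B n = w (pCons 0 (P (Suc n)) * P (Suc n)) / h (Suc n)" for n
  define C where "C n = h (Suc n) / h n" for n
  have "P (Suc (Suc n)) = [:- B n, 1:] * P (Suc n) - smult (C n) (P n)" for n
  proof -
    define f where "f = P (Suc (Suc n)) - [:- B n, 1:] * P (Suc n) + smult (C n) (P n)"
    have f: "f = P (Suc (Suc n)) - pCons 0 (P (Suc n)) + smult (B n) (P (Suc n)) + smult (C n) (P n)"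
      by (simp add: f_def)
    have fP: "w (f * P j) = w (P (Suc (Suc n)) * P j) - w (pCons 0 (P (Suc n)) * P j)
        + B n * w (P (Suc n) * P j) + C n * w (P n * P j)" for j
      unfolding f by (simp only: wl distrib_right left_diff_distrib mult_smult_left)
    have df: "degree f < Suc (Suc n)"
    proof -
      have "degree f \<le> Suc (Suc n)"
        unfolding f
        by (intro degree_add_le degree_diff_le) (auto simp: deg intro: order.trans[OF degree_smult_le]
            order.trans[OF degree_pCons_le])
      moreover have "coeff f (Suc (Suc n)) = 0"
        unfolding f by (simp add: lead coeff_eq_0 deg)
      ultimately show ?thesis
        by (metis degree_0 le_neq_implies_less leading_coeff_0_iff zero_less_Suc)
    qed
    have fj: "w (f * P j) = 0" if "j < Suc (Suc n)" for j
    proof -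
      consider "j = Suc n" | "j = n" | "j < n" using \<open>j < Suc (Suc n)\<close> less_antisym by blast
      then show ?thesis
      proof cases
        case 1
        then show ?thesis unfolding fP by (simp add: w B_def h)
      next
        case 2
        have "w (pCons 0 (P n) * P (Suc n)) = h (Suc n)"
          by (subst lead_w) (auto simp: deg lead intro: order.trans[OF degree_pCons_le])
        moreover have "pCons 0 (P (Suc n)) * P n = pCons 0 (P n) * P (Suc n)"
          by (simp add: mult.commute)
        ultimately have "w (f * P n) = - h (Suc n) + C n * h n"
          unfolding fP by (simp only: w) simp
        then show ?thesis using 2 by (simp add: C_def h)
      next
        case 3
        have "w (pCons 0 (P j) * P (Suc n)) = 0"
          by (rule orth) (use 3 deg[of j] degree_pCons_le[of 0 "P j"] in auto)
        moreover have "pCons 0 (P (Suc n)) * P j = pCons 0 (P j) * P (Suc n)"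
          by (simp add: mult.commute)
        ultimately show ?thesis using 3 unfolding fP by (simp only: w) simp
      qed
    qed
    have "f = 0"
    proof (rule ccontr)
      assume "f \<noteq> 0"
      with lead_w[of f "degree f"] fj[OF df] h show False by simp
    qed
    then show ?thesis by (simp add: f_def algebra_simps)
  qed
  moreover have "C n \<noteq> 0" for n by (simp add: C_def h)
  ultimately show thesis by (rule that)
qed

section \<open>Abstract operators and their action on Hermite polynomials\<close>

text \<open>\<open>D\<close> and \<open>S\<close> model the operators of base t^2, where x(1/2) = (t
  + 1/t)/2 and x(1/2)^2 - 1 = ((t - 1/t)/2)^2. The assumptions are invariant under t -> 1/t but the
  family \<open>H\<close> below is not, so interpreting the same operators at both values yields
  both families.\<close>

locale lattice_operators =
  fixes D S :: "complex poly \<Rightarrow> complex poly" and t :: real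
  assumes t_pos: "0 < t" and t_ne_1: "t \<noteq> 1"
    and D_diff: "D (p - r) = D p - D r"
    and D_smult: "D (smult c p) = smult c (D p)" and D_0: "D 0 = 0"
    and S_diff: "S (p - r) = S p - S r" and S_smult: "S (smult c p) = smult c (S p)" and S_0: "S 0 = 0"
    and D_pCons: "D (pCons c p) = S p + smult ((t + 1 / t) / 2) (pCons 0 (D p))"
    and S_pCons: "S (pCons c p) = [:c:] + smult ((t + 1 / t) / 2) (pCons 0 (S p))
      + smult (((t - 1 / t) / 2)\<^sup>2) ([:-1, 0, 1:] * D p)"
begin

text \<open>The symmetric q-number t^(n-1) + t^(n-3) + ... + t^(1-n), which replaces the factor n of
  ordinary differentiation.\<close>

definition \<gamma> :: "nat \<Rightarrow> complex" where
  "\<gamma> n = (of_real t ^ n - 1 / of_real t ^ n) / (of_real t - 1 / of_real t)"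

lemma t_sq_ne_1: "complex_of_real t ^ 2 \<noteq> 1"
  using t_pos t_ne_1 by (metis of_real_eq_1_iff of_real_power abs_of_pos power2_eq_1_iff less_irrefl
      neg_0_less_iff_less not_one_less_zero one_neq_neg_one)

lemma t_sub_inv: "complex_of_real t - 1 / of_real t \<noteq> 0"
  using t_sq_ne_1 t_pos by (auto simp: field_simps power2_eq_square)

lemma \<gamma>_0 [simp]: "\<gamma> 0 = 0" and \<gamma>_1 [simp]: "\<gamma> (Suc 0) = 1"
  using t_sub_inv by (simp_all add: \<gamma>_def)

lemma \<gamma>_nonzero: "n \<noteq> 0 \<Longrightarrow> \<gamma> n \<noteq> 0"
proof -
  assume n: "n \<noteq> 0"
  have "t ^ n \<noteq> 1" using t_pos t_ne_1 n power_eq_iff_eq_base[of n t 1] by simp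
  then have "(t ^ n)\<^sup>2 \<noteq> 1" using t_pos
    by (metis abs_of_pos power2_eq_1_iff zero_less_power less_irrefl neg_0_less_iff_less not_one_less_zero one_neq_neg_one)
  then have "complex_of_real ((t ^ n)\<^sup>2) \<noteq> 1" by (metis of_real_eq_1_iff)
  then show ?thesis using t_sub_inv t_pos
    by (simp add: \<gamma>_def field_simps power2_eq_square)
qed

abbreviation H :: "nat \<Rightarrow> complex poly" where "H \<equiv> rogers_hermite (t ^ 2)"

text \<open>With (t^2)^n written as (t^n)^2, raising n by one only multiplies t^n by t.\<close>

definition c :: "nat \<Rightarrow> complex" where "c n = (1 - (of_real t ^ n)\<^sup>2) / 4"

lemma H_Suc: "H (Suc n) = pCons 0 (H n) - smult (c n) (prev H n)"
  by (cases n) (simp_all add: prev_def c_def power_mult_distrib power2_eq_square mult_ac)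

text \<open>The formula for \<open>S (H n)\<close> is what closes the induction for \<open>D\<close>.\<close>

lemma operators_H:
  "D (H n) = smult (\<gamma> n) (prev H n) \<and>
   S (H n) = smult (1 / of_real t ^ n) (H n) + smult ((t - 1 / t) / 2 * \<gamma> n) (pCons 0 (prev H n))"
proof (induction n rule: induct_nat_012)
  case 0
  show ?case
    using D_pCons[of 1 0] S_pCons[of 1 0] by (simp add: D_0 S_0 prev_def one_pCons)
next
  case 1
  have one: "D 1 = 0" "S 1 = 1"
    using D_pCons[of 1 0] S_pCons[of 1 0] by (simp_all add: D_0 S_0 one_pCons)
  show ?case
    using D_pCons[of 0 1] S_pCons[of 0 1] t_pos
    by (simp add: one prev_def one_pCons[symmetric]) (simp add: one_pCons field_simps)
next
  case (ge2 n)
  define T where "T = complex_of_real t"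
  define X where "X = T ^ n"
  have nz: "T \<noteq> 0" "X \<noteq> 0" "T - 1 / T \<noteq> 0"
    using t_pos t_sub_inv by (auto simp: T_def X_def)
  then have T2: "T * T - 1 \<noteq> 0" by (auto simp: field_simps)
  define \<delta> where "\<delta> = (T - 1 / T) / 2"
  define \<alpha> where "\<alpha> = (T + 1 / T) / 2"
  have \<gamma>X: "\<gamma> n = (X - 1 / X) / (T - 1 / T)" "\<gamma> (Suc n) = (T * X - 1 / (T * X)) / (T - 1 / T)"
    "\<gamma> (Suc (Suc n)) = (T * (T * X) - 1 / (T * (T * X))) / (T - 1 / T)"
    by (simp_all add: \<gamma>_def X_def T_def)
  have cX: "c n = (1 - X\<^sup>2) / 4" "c (Suc n) = (1 - (T * X)\<^sup>2) / 4"
    by (simp_all add: c_def X_def T_def)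
  \<comment> \<open>The induction step reduces to these four scalar identities in \<open>T\<close>
    and \<open>X\<close>.\<close>
  have s1: "\<delta> + \<alpha> = T" "\<alpha> - \<delta> = 1 / T"
    by (simp_all add: \<delta>_def \<alpha>_def field_simps)
  have s2: "c (Suc n) * \<gamma> n = T * \<gamma> (Suc n) * c n"
    using nz unfolding cX \<gamma>X by (simp add: divide_simps T2) (simp add: algebra_simps power2_eq_square)
  have s3: "1 / (T * X) + T * \<gamma> (Suc n) = \<gamma> (Suc (Suc n))"
    using nz T2 unfolding \<gamma>X by (simp add: divide_simps) (simp add: algebra_simps power2_eq_square)
  have s4: "c (Suc n) / (T * (T * X)) - c (Suc n) / X = \<delta>\<^sup>2 * \<gamma> (Suc n)"
    using nz T2 unfolding cX \<gamma>X \<delta>_def by (simp add: divide_simps) (simp add: algebra_simps power2_eq_square)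
  have Hn: "H (Suc n) = pCons 0 (H n) - smult (c n) (prev H n)"
    and Hn2: "H (Suc (Suc n)) = pCons 0 (H (Suc n)) - smult (c (Suc n)) (H n)"
    using H_Suc[of n] H_Suc[of "Suc n"] by (simp_all add: prev_def)
  have D1: "D (H (Suc n)) = smult (\<gamma> (Suc n)) (H n)" and D0: "D (H n) = smult (\<gamma> n) (prev H n)"
    and S1: "S (H (Suc n)) = smult (1 / (T * X)) (H (Suc n)) + smult (\<delta> * \<gamma> (Suc n)) (pCons 0 (H n))"
    and S0: "S (H n) = smult (1 / X) (H n) + smult (\<delta> * \<gamma> n) (pCons 0 (prev H n))"
    using ge2 by (simp_all add: prev_def T_def X_def \<delta>_def)
  have \<alpha>': "complex_of_real ((t + 1 / t) / 2) = \<alpha>" "complex_of_real (((t - 1 / t) / 2)\<^sup>2) = \<delta>\<^sup>2"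
    by (simp_all add: \<alpha>_def \<delta>_def T_def)
  have 1: "D (H (Suc (Suc n))) = smult (\<gamma> (Suc (Suc n))) (H (Suc n))"
  proof (rule poly_ext)
    fix x
    define h0 h1 k where "h0 = poly (H n) x" and "h1 = poly (H (Suc n)) x" and "k = poly (prev H n) x"
    \<comment> \<open>The recurrence solved for its lowest term. By \<open>s2\<close> the term in
      \<open>k\<close> carries the factor \<open>c n\<close>, so \<open>k\<close> can be eliminated,
      and then the \<open>h0\<close> terms cancel.\<close>
    have h1: "c n * k = x * h0 - h1" unfolding h1_def Hn by (simp add: h0_def k_def)
    have "poly (D (H (Suc (Suc n)))) x
        = h1 / (T * X) + (\<delta> + \<alpha>) * \<gamma> (Suc n) * x * h0 - (c (Suc n) * \<gamma> n) * k"
      unfolding Hn2 D_diff D_smult D_pCons \<alpha>' D1 D0 S1 by (simp add: h0_def h1_def k_def algebra_simps)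
    also have "\<dots> = h1 / (T * X) + T * \<gamma> (Suc n) * x * h0 - T * \<gamma> (Suc n) * (c n * k)"
      unfolding s1 s2 by (simp only: mult.assoc)
    also have "\<dots> = (1 / (T * X) + T * \<gamma> (Suc n)) * h1"
      unfolding h1 by (simp add: algebra_simps)
    finally show "poly (D (H (Suc (Suc n)))) x = poly (smult (\<gamma> (Suc (Suc n))) (H (Suc n))) x"
      unfolding s3 by (simp add: h1_def)
  qed
  have 2: "S (H (Suc (Suc n))) = smult (1 / (T * (T * X))) (H (Suc (Suc n)))
      + smult (\<delta> * \<gamma> (Suc (Suc n))) (pCons 0 (H (Suc n)))"
  proof (rule poly_ext)
    fix x
    define h0 h1 k where "h0 = poly (H n) x" and "h1 = poly (H (Suc n)) x" and "k = poly (prev H n) x"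
    have h1: "c n * k = x * h0 - h1" unfolding h1_def Hn by (simp add: h0_def k_def)
    have h2: "poly (H (Suc (Suc n))) x = x * h1 - c (Suc n) * h0"
      unfolding Hn2 by (simp add: h0_def h1_def)
    have "poly (S (H (Suc (Suc n)))) x
        = \<alpha> * x * (h1 / (T * X) + \<delta> * \<gamma> (Suc n) * x * h0) + \<delta>\<^sup>2 * \<gamma> (Suc n) * (x\<^sup>2 - 1) * h0
          - c (Suc n) / X * h0 - \<delta> * x * ((c (Suc n) * \<gamma> n) * k)"
      unfolding Hn2 S_diff S_smult S_pCons \<alpha>' D1 S0 S1
      by (simp add: h0_def h1_def k_def algebra_simps power2_eq_square)
    also have "(c (Suc n) * \<gamma> n) * k = (\<delta> + \<alpha>) * \<gamma> (Suc n) * (x * h0 - h1)"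
      unfolding s1 s2 h1[symmetric] by (simp only: mult_ac)
    \<comment> \<open>Once \<open>k\<close> is eliminated, the terms in x^2 h0 cancel;
      \<open>s1\<close>, \<open>s3\<close> and \<open>s4\<close> then rebuild the recurrence for
      \<open>H (Suc (Suc n))\<close>.\<close>
    also have "\<alpha> * x * (h1 / (T * X) + \<delta> * \<gamma> (Suc n) * x * h0) + \<delta>\<^sup>2 * \<gamma> (Suc n) * (x\<^sup>2 - 1) * h0
          - c (Suc n) / X * h0 - \<delta> * x * ((\<delta> + \<alpha>) * \<gamma> (Suc n) * (x * h0 - h1))
        = (\<alpha> - \<delta>) * (1 / (T * X)) * x * h1 + \<delta> * (1 / (T * X) + (\<delta> + \<alpha>) * \<gamma> (Suc n)) * x * h1
          - (\<delta>\<^sup>2 * \<gamma> (Suc n) + c (Suc n) / X) * h0"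
      by (simp add: algebra_simps power2_eq_square diff_divide_distrib)
    also have "\<dots> = 1 / (T * (T * X)) * (x * h1 - c (Suc n) * h0) + \<delta> * \<gamma> (Suc (Suc n)) * x * h1"
      unfolding s1 s3 s4[symmetric] by (simp add: algebra_simps diff_divide_distrib)
    finally show "poly (S (H (Suc (Suc n)))) x = poly (smult (1 / (T * (T * X))) (H (Suc (Suc n)))
      + smult (\<delta> * \<gamma> (Suc (Suc n))) (pCons 0 (H (Suc n)))) x"
      unfolding poly_add poly_smult poly_pCons h2 by (simp add: h1_def mult_ac)
  qed
  show ?case using 1 2 by (simp add: prev_def T_def X_def \<delta>_def)
qed

lemma D_H: "D (H n) = smult (\<gamma> n) (prev H n)"
  using operators_H by blast

section \<open>The initial terms of an Appell sequence with a three-term recurrence\<close>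

text \<open>The top coefficients may be 0, so this covers every degree up to 5. The factors
  \<open>2 * \<alpha>\<close>, \<open>4 * \<alpha>\<^sup>2 - 1\<close> and so on are the Chebyshev
  polynomials of the second kind U_1, ..., U_4 at \<alpha>, that is, \<open>\<gamma> 2\<close> to
  \<open>\<gamma> 5\<close>.\<close>

lemma D_quintic:
  defines "\<alpha> \<equiv> complex_of_real ((t + 1 / t) / 2)"
  defines "e \<equiv> \<alpha>\<^sup>2 - 1"
  shows "D [:a0, a1, a2, a3, a4, a5:]
    = [:a1 - e * a3 + e\<^sup>2 * a5, 2 * \<alpha> * a2 - 4 * \<alpha> * e * a4,
       (4 * \<alpha>\<^sup>2 - 1) * a3 - e * (12 * \<alpha>\<^sup>2 - 2) * a5, (8 * \<alpha> ^ 3 - 4 * \<alpha>) * a4,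
       (16 * \<alpha> ^ 4 - 12 * \<alpha>\<^sup>2 + 1) * a5:]"
proof -
  have e: "complex_of_real (((t - 1 / t) / 2)\<^sup>2) = e"
    unfolding e_def \<alpha>_def using t_pos by (simp add: field_simps power2_eq_square)
  show ?thesis
    unfolding D_pCons S_pCons e D_0 S_0 \<alpha>_def[symmetric]
    by (simp add: e_def power2_eq_square power3_eq_cube power4_eq_xxxx algebra_simps)
qed


text \<open>Index shift: \<open>B n\<close> and \<open>C n\<close> stand for the \<open>B\<^bsub>n+1\<^esub>\<close> and \<open>C\<^bsub>n+1\<^esub>\<close> of the paper. Comparing
  coefficients in \<open>D P\<^sub>n = \<kappa>\<^sub>n P\<^bsub>n-1\<^esub>\<close> for \<open>n \<le> 5\<close>, the leading ones express all \<open>B n\<close> and \<open>C n\<close> through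
  \<open>\<beta>\<close> and \<open>C 0\<close>. Two constraints are left: the constant coefficient for \<open>n = 4\<close> (\<open>K1\<close>) says that
  \<open>\<beta> = 0\<close> or \<open>C 0 = (\<alpha> - 1) \<beta>\<^sup>2 - e / 2\<close>, and the one for \<open>n = 5\<close> (\<open>E0\<close>) becomes \<open>C 0 = 0\<close> in the
  second case and a quadratic equation for \<open>C 0\<close> in the first.\<close>

lemma Appell_initial_terms:
  assumes P01: "P 0 = 1" "P (Suc 0) = [:- \<beta>, 1:]"
    and rec: "\<And>n. P (Suc (Suc n)) = [:- B n, 1:] * P (Suc n) - smult (C n) (P n)"
    and C: "C 0 \<noteq> 0"
    and D: "\<And>n. D (P n) = smult (\<kappa> n) (prev P n)"
  shows "\<beta> = 0" and "P (Suc (Suc 0)) = [:- C 0, 0, 1:]"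
    and "C 0 = (1 - of_real t ^ 2) / 4 \<or> C 0 = (1 - 1 / of_real t ^ 2) / 4"
proof -
  define \<alpha> where "\<alpha> = complex_of_real ((t + 1 / t) / 2)"
  define e where "e = \<alpha>\<^sup>2 - 1"
  \<comment> \<open>\<open>g\<close> is the constant coefficient of \<open>P 2\<close>;
    \<open>r\<close> and \<open>s\<close> are the linear and constant coefficients of
    \<open>P 3\<close>, where \<open>r\<close> already uses the value of \<open>B 0\<close> found
    below.\<close>
  define g where "g = \<beta> * B 0 - C 0"
  define r where "r = g + 2 * \<alpha> * \<beta> * B 1 - C 1"
  define s where "s = C 1 * \<beta> - B 1 * g"
  \<comment> \<open>By the inequality of arithmetic and geometric means \<alpha> is a real number
    greater than 1, so the factors cancelled below are nonzero.\<close>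
  have \<alpha>: "\<alpha> \<noteq> 0" "\<alpha> \<noteq> 1" "2 * \<alpha> + 1 \<noteq> 0" "e \<noteq> 0" "4 * \<alpha>\<^sup>2 - 1 \<noteq> 0" "8 * \<alpha> ^ 3 - 4 * \<alpha> \<noteq> 0"
  proof -
    define a where "a = (t + 1 / t) / 2"
    have "a - 1 = (t - 1)\<^sup>2 / (2 * t)"
      unfolding a_def using t_pos by (simp add: field_simps power2_eq_square)
    moreover have "(t - 1)\<^sup>2 / (2 * t) > 0" using t_pos t_ne_1 by simp
    ultimately have a: "a > 1" by simp
    then have a2: "a\<^sup>2 > 1" by (simp add: power2_eq_square less_1_mult)
    have "8 * a ^ 3 - 4 * a = 4 * a * (2 * a\<^sup>2 - 1)"
      by (simp add: algebra_simps power2_eq_square power3_eq_cube)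
    moreover have "4 * a * (2 * a\<^sup>2 - 1) > 0" using a a2 by (intro mult_pos_pos) linarith+
    ultimately have a3: "8 * a ^ 3 - 4 * a \<noteq> 0" by linarith
    have eqs: "\<alpha> = of_real a" "\<alpha> - 1 = of_real (a - 1)" "2 * \<alpha> + 1 = of_real (2 * a + 1)"
      "e = of_real (a\<^sup>2 - 1)" "4 * \<alpha>\<^sup>2 - 1 = of_real (4 * a\<^sup>2 - 1)"
      "8 * \<alpha> ^ 3 - 4 * \<alpha> = of_real (8 * a ^ 3 - 4 * a)"
      by (simp_all add: \<alpha>_def a_def e_def)
    have "\<alpha> - 1 \<noteq> 0" by (simp only: eqs(2) of_real_eq_0_iff) (use a in linarith)
    then show "\<alpha> \<noteq> 1" by simp
    show "\<alpha> \<noteq> 0" by (simp only: eqs(1) of_real_eq_0_iff) (use a in linarith)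
    show "2 * \<alpha> + 1 \<noteq> 0" by (simp only: eqs(3) of_real_eq_0_iff) (use a in linarith)
    show "e \<noteq> 0" by (simp only: eqs(4) of_real_eq_0_iff) (use a2 in linarith)
    show "4 * \<alpha>\<^sup>2 - 1 \<noteq> 0" by (simp only: eqs(5) of_real_eq_0_iff) (use a2 in linarith)
    show "8 * \<alpha> ^ 3 - 4 * \<alpha> \<noteq> 0" unfolding eqs(6) of_real_eq_0_iff by (rule a3)
  qed
  then have \<alpha>': "2 * \<alpha> \<noteq> 0" by simp
  note D_quintic = D_quintic[folded \<alpha>_def, folded e_def]
  have cubic: "D [:a0, a1, a2, a3:] = [:a1 - e * a3, 2 * \<alpha> * a2, (4 * \<alpha>\<^sup>2 - 1) * a3:]" for a0 a1 a2 a3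
    using D_quintic[of a0 a1 a2 a3 0 0] by simp
  have rec_numeral: "P 3 = [:- B 1, 1:] * P 2 - smult (C 1) (P 1)"
    "P 4 = [:- B 2, 1:] * P 3 - smult (C 2) (P 2)" "P 5 = [:- B 3, 1:] * P 4 - smult (C 3) (P 3)"
    using rec[of 1] rec[of 2] rec[of 3] by (simp_all add: eval_nat_numeral)
  have D_numeral: "D (P 2) = smult (\<kappa> 2) (P 1)" "D (P 3) = smult (\<kappa> 3) (P 2)"
    "D (P 4) = smult (\<kappa> 4) (P 3)" "D (P 5) = smult (\<kappa> 5) (P 4)"
    using D[of 2] D[of 3] D[of 4] D[of 5] by (simp_all add: prev_def eval_nat_numeral)
  \<comment> \<open>The polynomial on the right is monic, so the unknown scalar \<open>k\<close>
    equals the leading coefficient on the left and is eliminated.\<close>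
  have monic2: "x0 = x2 * y0 \<and> x1 = x2 * y1"
    if "[:x0, x1, x2:] = smult k [:y0, y1, 1:]" for x0 x1 x2 y0 y1 k :: complex
    using that by simp
  have monic3: "x0 = x3 * y0 \<and> x1 = x3 * y1 \<and> x2 = x3 * y2"
    if "[:x0, x1, x2, x3:] = smult k [:y0, y1, y2, 1:]" for x0 x1 x2 x3 y0 y1 y2 k :: complex
    using that by simp
  have monic4: "x0 = x4 * y0 \<and> x1 = x4 * y1 \<and> x2 = x4 * y2 \<and> x3 = x4 * y3"
    if "[:x0, x1, x2, x3, x4:] = smult k [:y0, y1, y2, y3, 1:]" for x0 x1 x2 x3 x4 y0 y1 y2 y3 k :: complex
    using that by simp
  have quartic: "D [:a0, a1, a2, a3, a4:] = [:a1 - e * a3, 2 * \<alpha> * a2 - 4 * \<alpha> * e * a4,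
      (4 * \<alpha>\<^sup>2 - 1) * a3, (8 * \<alpha> ^ 3 - 4 * \<alpha>) * a4:]" for a0 a1 a2 a3 a4
    using D_quintic[of a0 a1 a2 a3 a4 0] by simp
  have P2: "P 2 = [:g, - \<beta> - B 0, 1:]"
    using rec[of 0] P01 by (simp add: g_def numeral_2_eq_2)
  have "- \<beta> - B 0 = - (2 * \<alpha> * \<beta>)"
    using D_numeral(1) unfolding P2 by (simp add: cubic[of _ _ _ 0, simplified] P01)
  then have B0: "B 0 = 2 * \<alpha> * \<beta> - \<beta>" and P2: "P 2 = [:g, - (2 * \<alpha> * \<beta>), 1:]"
    using P2 by (simp_all add: algebra_simps)
  have P3: "P 3 = [:s, r, - (2 * \<alpha> * \<beta>) - B 1, 1:]"
    unfolding rec_numeral(1) P2 by (simp add: P01 s_def r_def algebra_simps)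
  have "2 * \<alpha> * (- (2 * \<alpha> * \<beta>) - B 1) = (4 * \<alpha>\<^sup>2 - 1) * (- (2 * \<alpha> * \<beta>))"
    and r: "r - e = (4 * \<alpha>\<^sup>2 - 1) * g"
    using monic2[OF D_numeral(2)[unfolded P3 P2 cubic], unfolded mult_1_right] by blast+
  then have "2 * \<alpha> * B 1 = 2 * \<alpha> * ((4 * \<alpha>\<^sup>2 - 1) * \<beta> - 2 * \<alpha> * \<beta>)" by algebra
  then have B1: "B 1 = (4 * \<alpha>\<^sup>2 - 1) * \<beta> - 2 * \<alpha> * \<beta>"
    by (simp only: mult_left_cancel[OF \<alpha>'])
  from r have r: "r = e + (4 * \<alpha>\<^sup>2 - 1) * g" by algebra
  have P3: "P 3 = [:s, r, - ((4 * \<alpha>\<^sup>2 - 1) * \<beta>), 1:]"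
    unfolding P3 B1 by simp
  define b4 where "b4 = r + B 2 * (4 * \<alpha>\<^sup>2 - 1) * \<beta> - C 2"
  define c4 where "c4 = s - B 2 * r + 2 * \<alpha> * \<beta> * C 2"
  define d4 where "d4 = - B 2 * s - C 2 * g"
  have P4: "P 4 = [:d4, c4, b4, - ((4 * \<alpha>\<^sup>2 - 1) * \<beta>) - B 2, 1:]"
    unfolding rec_numeral(2) P2 P3 by (simp add: b4_def c4_def d4_def algebra_simps)
  have "(4 * \<alpha>\<^sup>2 - 1) * (- ((4 * \<alpha>\<^sup>2 - 1) * \<beta>) - B 2) = (8 * \<alpha> ^ 3 - 4 * \<alpha>) * (- ((4 * \<alpha>\<^sup>2 - 1) * \<beta>))"
    and b4: "2 * \<alpha> * b4 - 4 * \<alpha> * e = (8 * \<alpha> ^ 3 - 4 * \<alpha>) * r"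
    and K1: "c4 - e * (- ((4 * \<alpha>\<^sup>2 - 1) * \<beta>) - B 2) = (8 * \<alpha> ^ 3 - 4 * \<alpha>) * s"
    using monic3[OF D_numeral(3)[unfolded P4 P3 quartic], unfolded mult_1_right] by blast+
  then have "(4 * \<alpha>\<^sup>2 - 1) * B 2 = (4 * \<alpha>\<^sup>2 - 1) * ((8 * \<alpha> ^ 3 - 4 * \<alpha>) * \<beta> - (4 * \<alpha>\<^sup>2 - 1) * \<beta>)"
    by algebra
  then have B2: "B 2 = (8 * \<alpha> ^ 3 - 4 * \<alpha>) * \<beta> - (4 * \<alpha>\<^sup>2 - 1) * \<beta>"
    by (simp only: mult_left_cancel[OF \<alpha>(5)])
  from b4 have "2 * \<alpha> * b4 = 2 * \<alpha> * (2 * e + (4 * \<alpha>\<^sup>2 - 2) * r)" by algebra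
  then have b4: "b4 = 2 * e + (4 * \<alpha>\<^sup>2 - 2) * r"
    by (simp only: mult_left_cancel[OF \<alpha>'])
  have P4: "P 4 = [:d4, c4, b4, - ((8 * \<alpha> ^ 3 - 4 * \<alpha>) * \<beta>), 1:]"
    unfolding P4 B2 by simp
  define b5 where "b5 = b4 + B 3 * (8 * \<alpha> ^ 3 - 4 * \<alpha>) * \<beta> - C 3"
  define c5 where "c5 = c4 - B 3 * b4 + C 3 * (4 * \<alpha>\<^sup>2 - 1) * \<beta>"
  define d5 where "d5 = d4 - B 3 * c4 - C 3 * r"
  have P5: "P 5 = [:- B 3 * d4 - C 3 * s, d5, c5, b5, - ((8 * \<alpha> ^ 3 - 4 * \<alpha>) * \<beta>) - B 3, 1:]"
    unfolding rec_numeral(3) P3 P4 by (simp add: b5_def c5_def d5_def algebra_simps)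
  have "(8 * \<alpha> ^ 3 - 4 * \<alpha>) * (- ((8 * \<alpha> ^ 3 - 4 * \<alpha>) * \<beta>) - B 3)
        = (16 * \<alpha> ^ 4 - 12 * \<alpha>\<^sup>2 + 1) * (- ((8 * \<alpha> ^ 3 - 4 * \<alpha>) * \<beta>))"
    and b5: "(4 * \<alpha>\<^sup>2 - 1) * b5 - e * (12 * \<alpha>\<^sup>2 - 2) = (16 * \<alpha> ^ 4 - 12 * \<alpha>\<^sup>2 + 1) * b4"
    and E0: "d5 - e * b5 + e\<^sup>2 = (16 * \<alpha> ^ 4 - 12 * \<alpha>\<^sup>2 + 1) * d4"
    using monic4[OF D_numeral(4)[unfolded P5 P4 D_quintic], unfolded mult_1_right] by blast+
  then have "(8 * \<alpha> ^ 3 - 4 * \<alpha>) * B 3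
        = (8 * \<alpha> ^ 3 - 4 * \<alpha>) * ((16 * \<alpha> ^ 4 - 12 * \<alpha>\<^sup>2 + 1) * \<beta> - (8 * \<alpha> ^ 3 - 4 * \<alpha>) * \<beta>)"
    by algebra
  then have B3: "B 3 = (16 * \<alpha> ^ 4 - 12 * \<alpha>\<^sup>2 + 1) * \<beta> - (8 * \<alpha> ^ 3 - 4 * \<alpha>) * \<beta>"
    by (simp only: mult_left_cancel[OF \<alpha>(6)])
  from b5 have b5: "(4 * \<alpha>\<^sup>2 - 1) * b5 = e * (12 * \<alpha>\<^sup>2 - 2) + (16 * \<alpha> ^ 4 - 12 * \<alpha>\<^sup>2 + 1) * b4"
    by algebra
  from E0 have E0: "d5 - e * b5 + e\<^sup>2 - (16 * \<alpha> ^ 4 - 12 * \<alpha>\<^sup>2 + 1) * d4 = 0" by algebra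
  have g: "g = (2 * \<alpha> - 1) * \<beta>\<^sup>2 - C 0"
    unfolding g_def B0 by (simp add: algebra_simps power2_eq_square)
  have C1: "C 1 = g + 2 * \<alpha> * \<beta> * B 1 - r" by (simp add: r_def)
  have C2: "C 2 = r + B 2 * (4 * \<alpha>\<^sup>2 - 1) * \<beta> - b4" by (simp add: b4_def)
  have C3: "C 3 = b4 + B 3 * (8 * \<alpha> ^ 3 - 4 * \<alpha>) * \<beta> - b5" by (simp add: b5_def)
  have "2 * (2 * \<alpha> + 1) * (\<alpha> - 1) * (\<beta> * (2 * C 0 + e - 2 * (\<alpha> - 1) * \<beta>\<^sup>2))
      = c4 - e * (- ((4 * \<alpha>\<^sup>2 - 1) * \<beta>) - B 2) - (8 * \<alpha> ^ 3 - 4 * \<alpha>) * s"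
    unfolding c4_def s_def C2 C1 b4 B2 B1 r g e_def
    by (simp add: algebra_simps power2_eq_square power3_eq_cube)
  also have "\<dots> = 0" unfolding K1 by simp
  finally have "2 * (2 * \<alpha> + 1) * (\<alpha> - 1) * (\<beta> * (2 * C 0 + e - 2 * (\<alpha> - 1) * \<beta>\<^sup>2)) = 0" .
  then have "\<beta> * (2 * C 0 + e - 2 * (\<alpha> - 1) * \<beta>\<^sup>2) = 0"
    using \<alpha>(2,3) by (simp only: mult_eq_0_iff) simp
  then have K: "C 0 = (\<alpha> - 1) * \<beta>\<^sup>2 - e / 2" if "\<beta> \<noteq> 0"
  proof -
    from \<open>\<beta> * (2 * C 0 + e - 2 * (\<alpha> - 1) * \<beta>\<^sup>2) = 0\<close> that
    have "2 * C 0 + e - 2 * (\<alpha> - 1) * \<beta>\<^sup>2 = 0" by (simp only: mult_eq_0_iff) simp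
    then show ?thesis by (simp add: field_simps)
  qed
  \<comment> \<open>Only the product of \<open>b5\<close> with
    \<open>4 * \<alpha>\<^sup>2 - 1\<close> is known. Through \<open>C 3\<close> and the term
    \<open>e * b5\<close> it enters with total factor \<open>r - e\<close>, so the whole equation is
    multiplied by that constant.\<close>
  have "(4 * \<alpha>\<^sup>2 - 1) * (d5 - e * b5 + e\<^sup>2 - (16 * \<alpha> ^ 4 - 12 * \<alpha>\<^sup>2 + 1) * d4)
      = (4 * \<alpha>\<^sup>2 - 1) * (d4 - B 3 * c4 - r * (b4 + B 3 * (8 * \<alpha> ^ 3 - 4 * \<alpha>) * \<beta>) + e\<^sup>2
          - (16 * \<alpha> ^ 4 - 12 * \<alpha>\<^sup>2 + 1) * d4) + (r - e) * ((4 * \<alpha>\<^sup>2 - 1) * b5)"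
    unfolding d5_def C3 by (simp add: algebra_simps)
  then have E0: "(4 * \<alpha>\<^sup>2 - 1) * (d4 - B 3 * c4 - r * (b4 + B 3 * (8 * \<alpha> ^ 3 - 4 * \<alpha>) * \<beta>) + e\<^sup>2
          - (16 * \<alpha> ^ 4 - 12 * \<alpha>\<^sup>2 + 1) * d4)
      + (r - e) * (e * (12 * \<alpha>\<^sup>2 - 2) + (16 * \<alpha> ^ 4 - 12 * \<alpha>\<^sup>2 + 1) * b4) = 0"
    unfolding E0 b5 by simp
  show \<beta>: "\<beta> = 0"
  proof (rule ccontr)
    assume "\<beta> \<noteq> 0"
    note C0 = K[OF this]
    have "- 4 * ((4 * \<alpha>\<^sup>2 - 1)\<^sup>2 * \<alpha>\<^sup>2 * (C 0)\<^sup>2) = 0"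
      by (rule trans[OF _ E0], unfold d4_def c4_def s_def C2 C1 b4 B3 B2 B1 r g C0 e_def)
        (simp add: field_simps power2_eq_square power3_eq_cube power4_eq_xxxx)
    then show False using \<alpha> C by simp
  qed
  have "(4 * \<alpha>\<^sup>2 - 1)\<^sup>2 * (e * (4 * (C 0)\<^sup>2 + 4 * e * C 0 - e)) = 0"
    by (rule trans[OF _ E0], unfold d4_def c4_def s_def C2 C1 b4 B3 B2 B1 r g \<beta> e_def)
      (simp add: algebra_simps power2_eq_square power3_eq_cube power4_eq_xxxx)
  then have quadratic: "4 * (C 0)\<^sup>2 + 4 * e * C 0 - e = 0" using \<alpha> by simp
  have e: "e = (of_real t - 1 / of_real t)\<^sup>2 / 4"
    unfolding e_def \<alpha>_def using t_pos by (simp add: field_simps power2_eq_square)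
  \<comment> \<open>The two values have sum -e and product -e/4, so they are the roots of the
    quadratic; they are the first recurrence coefficients of the Hermite families of base t^2 and
    1/t^2.\<close>
  have "(C 0 - (1 - of_real t ^ 2) / 4) * (C 0 - (1 - 1 / of_real t ^ 2) / 4)
      = (4 * (C 0)\<^sup>2 + 4 * e * C 0 - e) / 4"
    unfolding e using t_pos by (simp add: field_simps power2_eq_square)
  also have "\<dots> = 0" unfolding quadratic by simp
  finally have "(C 0 - (1 - of_real t ^ 2) / 4) * (C 0 - (1 - 1 / of_real t ^ 2) / 4) = 0" .
  then show "C 0 = (1 - of_real t ^ 2) / 4 \<or> C 0 = (1 - 1 / of_real t ^ 2) / 4"
    by simp
  show "P (Suc (Suc 0)) = [:- C 0, 0, 1:]"
    using P2 by (simp add: g \<beta> numeral_2_eq_2)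
qed

section \<open>Uniqueness of the sequence with given initial terms\<close>

lemma degree_H: "degree (H n) \<le> n" and coeff_H: "coeff (H n) n = 1"
proof -
  have "degree (H n) \<le> n \<and> coeff (H n) n = 1"
  proof (induction n rule: induct_nat_012)
    case (ge2 n)
    have H: "H (Suc (Suc n)) = pCons 0 (H (Suc n)) - smult (c (Suc n)) (H n)"
      using H_Suc[of "Suc n"] by (simp add: prev_def)
    have "degree (H (Suc (Suc n))) \<le> Suc (Suc n)"
      unfolding H using ge2
      by (intro degree_diff_le order.trans[OF degree_pCons_le] order.trans[OF degree_smult_le]) auto
    moreover have "coeff (H n) (Suc (Suc n)) = 0" using ge2 by (intro coeff_eq_0) simp
    ultimately show ?case using ge2 unfolding H by simp
  qed simp_all
  then show "degree (H n) \<le> n" "coeff (H n) n = 1" by auto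
qed

lemma coeff_H_eq_0: "n < m \<Longrightarrow> coeff (H n) m = 0"
  using degree_H[of n] by (simp add: coeff_eq_0)

lemma Appell_eq_H:
  assumes init: "P 0 = H 0" "P (Suc 0) = H (Suc 0)" "P (Suc (Suc 0)) = H (Suc (Suc 0))"
    and rec: "\<And>n. P (Suc (Suc n)) = [:- B n, 1:] * P (Suc n) - smult (C n) (P n)"
    and D: "\<And>n. D (P n) = smult (\<kappa> n) (prev P n)"
  shows "P = H"
proof -
  \<comment> \<open>Three initial terms are needed: the lower correction term must be a multiple of
    some \<open>H (Suc n)\<close>, since \<open>D (H 0) = 0\<close> would leave its coefficient
    \<open>d\<close> undetected.\<close>
  have "P n = H n \<and> P (Suc n) = H (Suc n) \<and> P (Suc (Suc n)) = H (Suc (Suc n))" for n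
  proof (induction n)
    case 0
    show ?case using init by simp
  next
    case (Suc n)
    let ?n1 = "Suc n" and ?n2 = "Suc (Suc n)" and ?n3 = "Suc (Suc (Suc n))"
    define b where "b = B ?n1"
    define d where "d = C ?n1 - c ?n2"
    have P3: "P ?n3 = H ?n3 - smult b (H ?n2) - smult d (H ?n1)"
      using Suc rec[of ?n1] H_Suc[of ?n2]
      by (simp add: prev_def b_def d_def smult_diff_left del: rogers_hermite.simps)
    have eq: "smult (\<kappa> ?n3) (H ?n2)
        = smult (\<gamma> ?n3) (H ?n2) - smult (b * \<gamma> ?n2) (H ?n1) - smult (d * \<gamma> ?n1) (H n)"
      using D[of ?n3] Suc unfolding P3 D_diff D_smult D_H by (simp add: prev_def del: rogers_hermite.simps)
    \<comment> \<open>The three Hermite polynomials have distinct degrees, so comparing coefficients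
      from the top down gives \<open>\<kappa>\<close>, then \<open>b\<close>, then
      \<open>d\<close>.\<close>
    have "\<kappa> ?n3 = \<gamma> ?n3"
      using arg_cong[OF eq, of "\<lambda>p. coeff p ?n2"] by (simp add: coeff_H coeff_H_eq_0 del: rogers_hermite.simps)
    with eq have eq: "smult (b * \<gamma> ?n2) (H ?n1) + smult (d * \<gamma> ?n1) (H n) = 0"
      by (simp add: algebra_simps del: rogers_hermite.simps)
    have b: "b = 0"
      using arg_cong[OF eq, of "\<lambda>p. coeff p ?n1"] \<gamma>_nonzero[of ?n2]
      by (simp add: coeff_H coeff_H_eq_0 del: rogers_hermite.simps)
    have "d = 0"
      using arg_cong[OF eq, of "\<lambda>p. coeff p n"] \<gamma>_nonzero[of ?n1] b
      by (simp add: coeff_H coeff_H_eq_0 del: rogers_hermite.simps)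
    with b P3 Suc show ?case by simp
  qed
  then show ?thesis by blast
qed

end

section \<open>Specialisation to base q^2 and the equivalence\<close>

text \<open>The value x(1/2) for base q^2 is (q + 1/q)/2, which does not change under q ->
  1/q.\<close>

lemma lattice_operators_askey_wilson:
  assumes "0 < q" "q \<noteq> 1" and t: "t = q \<or> t = 1 / q"
  shows "lattice_operators (askey_wilson (q\<^sup>2)) (averaging (q\<^sup>2)) t"
proof -
  have q2: "0 < q\<^sup>2" "q\<^sup>2 \<noteq> 1" using assms by (auto simp: power2_eq_1_iff)
  have "exp (complex_of_real (ln q)) = of_real q" "exp (- complex_of_real (ln q)) = of_real (1 / q)"
    using assms(1) by (simp_all add: exp_of_real exp_minus inverse_eq_divide)
  then have "qx (q\<^sup>2) (1/2) = (of_real q + of_real (1 / q)) / 2"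
    using qx_exp[OF q2(1), of "1/2"] assms(1) by (simp add: ln_realpow)
  then have \<alpha>: "qx (q\<^sup>2) (1/2) = complex_of_real ((t + 1 / t) / 2)"
    using t by (auto simp: add.commute)
  have tp: "0 < t" "t \<noteq> 1" using assms by auto
  have \<delta>: "(complex_of_real ((t + 1 / t) / 2))\<^sup>2 - 1 = complex_of_real (((t - 1 / t) / 2)\<^sup>2)"
    using tp by (simp add: field_simps power2_eq_square)
  show ?thesis
    by unfold_locales
      (use tp operators_pCons[OF q2, unfolded \<alpha> \<delta>] askey_wilson_linear[OF q2] averaging_linear[OF q2] in auto)
qed

theorem theorem4p1:
  fixes q :: real and P :: "nat \<Rightarrow> complex poly"
  assumes "0 < q" and "q < 1" and "monic_OPS P"
  shows "(\<exists>k :: nat \<Rightarrow> complex. \<forall>n. askey_wilson q (averaging q (P n)) = smult (k n) (prev P n))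
    \<longleftrightarrow> P = rogers_hermite (q ^ 2) \<or> P = rogers_hermite (q powi (-2))"
proof -
  have q: "0 < q" "q \<noteq> 1" using assms by auto
  interpret A: lattice_operators "askey_wilson (q\<^sup>2)" "averaging (q\<^sup>2)" q
    using lattice_operators_askey_wilson[OF q] by blast
  interpret B: lattice_operators "askey_wilson (q\<^sup>2)" "averaging (q\<^sup>2)" "1 / q"
    using lattice_operators_askey_wilson[OF q] by blast
  have inv: "q powi (-2) = (1 / q)\<^sup>2"
    by (simp add: power_int_minus power_one_over inverse_eq_divide)
  define a where "a = qx q (1/2)"
  \<comment> \<open>This is cosh of a real number, hence nonzero, and the factor can be divided
    out.\<close>
  have "a = complex_of_real ((exp (ln q / 2) + exp (- (ln q / 2))) / 2)"
    using q by (simp add: a_def qx_exp exp_of_real[symmetric])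
  moreover have "(exp (ln q / 2) + exp (- (ln q / 2))) / 2 > 0" by (simp add: add_pos_pos)
  ultimately have a: "a \<noteq> 0" by (metis less_irrefl of_real_eq_0_iff)
  note DS = askey_wilson_averaging[OF q, folded a_def]
  show ?thesis
  proof
    assume "\<exists>k. \<forall>n. askey_wilson q (averaging q (P n)) = smult (k n) (prev P n)"
    then obtain k where k: "\<And>n. askey_wilson q (averaging q (P n)) = smult (k n) (prev P n)" by blast
    have D: "askey_wilson (q\<^sup>2) (P n) = smult (k n / a) (prev P n)" for n
    proof -
      have "smult (1 / a) (smult a (askey_wilson (q\<^sup>2) (P n))) = smult (1 / a) (smult (k n) (prev P n))"
        using k[of n] unfolding DS by simp
      then show ?thesis using a by simp
    qed
    from assms(3) obtain B C where rec: "\<And>n. P (Suc (Suc n)) = [:- B n, 1:] * P (Suc n) - smult (C n) (P n)"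
      and C: "\<And>n. C n \<noteq> 0"
      using monic_OPS_recurrence by metis
    have deg: "degree (P n) = n" "coeff (P n) n = 1" for n
      using assms(3) unfolding monic_OPS_def by metis+
    have P0: "P 0 = 1"
      using deg[of 0] by (metis degree_eq_zeroE coeff_pCons_0 one_pCons)
    \<comment> \<open>The double negation matches the form \<open>[:- \<beta>, 1:]\<close> in
      \<open>Appell_initial_terms\<close>.\<close>
    have P1: "P (Suc 0) = [:- (- coeff (P (Suc 0)) 0), 1:]"
      by (rule poly_eqI) (use deg[of "Suc 0"] in \<open>auto simp: coeff_pCons coeff_eq_0 split: nat.split\<close>)
    note init = A.Appell_initial_terms[OF P0 P1 rec C D]
    have P1: "P (Suc 0) = [:0, 1:]" using P1 init(1) by simp
    \<comment> \<open>Both values of \<open>C 0\<close> come from the interpretation at q. The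
      second is the first with 1/q in place of q, so uniqueness is then applied in the
      interpretation at 1/q.\<close>
    from init(3) show "P = rogers_hermite (q ^ 2) \<or> P = rogers_hermite (q powi (-2))"
    proof
      assume "C 0 = (1 - complex_of_real q ^ 2) / 4"
      then have "P = rogers_hermite (q ^ 2)"
        by (intro A.Appell_eq_H[OF _ _ _ rec D]) (simp_all add: P0 P1 init(2) one_pCons)
      then show ?thesis ..
    next
      assume "C 0 = (1 - 1 / complex_of_real q ^ 2) / 4"
      then have "P = rogers_hermite ((1 / q) ^ 2)"
        by (intro B.Appell_eq_H[OF _ _ _ rec D]) (simp_all add: P0 P1 init(2) one_pCons power_one_over)
      then show ?thesis unfolding inv ..
    qed
  next
    assume "P = rogers_hermite (q ^ 2) \<or> P = rogers_hermite (q powi (-2))"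
    then obtain g where "\<And>n. askey_wilson (q\<^sup>2) (P n) = smult (g n) (prev P n)"
      unfolding inv using A.D_H B.D_H by metis
    then show "\<exists>k. \<forall>n. askey_wilson q (averaging q (P n)) = smult (k n) (prev P n)"
      unfolding DS by (intro exI[of _ "\<lambda>n. a * g n"]) simp
  qed
qed

end
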